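(* Let $X$ be a compact metric space, let $f\colon X\to X$ be a homeomorphism, and let $\Lambda$ be an attractor for $f$. If $X$ is locally connected, then $\partial\Lambda$ has only finitely many connected components.
   Context: An attractor for a homeomorphism $f$ is a closed subset $\Lambda$ of $X$ with $f(\Lambda)=\Lambda$ such that there is an open subset $U$ of $X$ with $f(\overline{U})\subset U$ and $\Lambda=\bigcap_{i\ge0}f^i(U)$. $\partial\Lambda=\overline{\Lambda}\setminus{\rm int}[\Lambda]$ is the boundary of $\Lambda$. $X$ is locally connected if for any $x\in X$ and any open $U\ni x$ there is an open connected $V$ with $x\in V\subset U$. *)

theory Defs
  imports "HOL-Analysis.Analysis"
begin

text \<open>
  The ambient space is a type of class \<^class>\<open>metric_space\<close>, so closure, openness and
  interior are taken in the whole space.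
\<close>

definition attractor :: "('a::topological_space \<Rightarrow> 'a) \<Rightarrow> 'a set \<Rightarrow> bool" where
  "attractor f \<Lambda> \<longleftrightarrow>
     closed \<Lambda> \<and> f ` \<Lambda> = \<Lambda> \<and>
     (\<exists>U. open U \<and> f ` closure U \<subseteq> U \<and> \<Lambda> = (\<Inter>i. (f ^^ i) ` U))"

text \<open>
  The library predicate \<open>locally connected\<close> only asks for connected, not necessarily open,
  neighbourhoods. On the whole space this is equivalent to the existence of a base of open
  connected sets.
\<close>

lemma locally_connected_UNIV_iff:
  "locally connected (UNIV :: 'a::topological_space set) \<longleftrightarrow>
     (\<forall>x (U :: 'a set). open U \<and> x \<in> U \<longrightarrow> (\<exists>V. open V \<and> connected V \<and> x \<in> V \<and> V \<subseteq> U))"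
  unfolding locally_connected by auto

end

theory Submission
  imports Defs
begin

text \<open>
  Let \<open>U\<close> be a trapping neighbourhood of \<open>\<Lambda>\<close>. By local connectedness and compactness only
  finitely many components of \<open>- \<Lambda>\<close> meet \<open>- U\<close>. A component of \<open>- \<Lambda>\<close> inside \<open>U\<close> would have
  infinitely many backward iterates meeting \<open>- U\<close>, hence would be periodic and thus contained in
  every \<open>f\<^sup>i(U)\<close>, that is, in \<open>\<Lambda>\<close>; so there is none. Consequently no component of \<open>U - \<Lambda>\<close> lies
  inside \<open>f(U)\<close>, and each one that meets \<open>f(U)\<close> crosses the compact set \<open>\<partial>f(U)\<close>. Hence there are
  only finitely many of these, say \<open>m\<close>. If \<open>P\<close> is their union, \<open>\<partial>\<Lambda>\<close> is the
  intersection of the decreasing compact sets \<open>f\<^sup>i(closure P)\<close>, each a union of \<open>m\<close> connected sets,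
  so it has at most \<open>m\<close> components.
\<close>

section \<open>Decreasing intersections of compact sets\<close>

lemma connected_INT_decseq:
  fixes L :: "nat \<Rightarrow> 'a::t4_space set"
  assumes "\<And>n. compact (L n)" and "\<And>n. connected (L n)" and "decseq L"
  shows "connected (\<Inter>n. L n)"
proof -
  have cl: "closed (L n)" for n
    using assms(1) compact_imp_closed by blast
  have False if AB: "closed A" "closed B" "A \<noteq> {}" "B \<noteq> {}" "A \<union> B = (\<Inter>n. L n)" "A \<inter> B = {}"
    for A B
  proof -
    obtain O1 O2 where O: "open O1" "open O2" "A \<subseteq> O1" "B \<subseteq> O2" "O1 \<inter> O2 = {}"
      using t4_space[OF AB(1,2,6)] by blast
    \<comment> \<open>A connected \<open>L N\<close> meets both \<open>O1\<close> and
      \<open>O2\<close>, so it cannot be covered by them. Compactness turns these leftovers into one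
      point of every \<open>L n\<close> outside both neighbourhoods.\<close>
    have "L 0 \<inter> (\<Inter>n. L n - (O1 \<union> O2)) \<noteq> {}"
    proof (rule compact_imp_fip_image)
      show "compact (L 0)" by fact
      show "closed (L n - (O1 \<union> O2))" for n
        using cl O by (simp add: closed_Diff open_Un)
      fix I :: "nat set" assume "finite I" "I \<subseteq> UNIV"
      define N where "N = Max (insert 0 I)"
      have N: "L N \<subseteq> L n" if "n \<in> insert 0 I" for n
        using that \<open>finite I\<close> \<open>decseq L\<close> unfolding N_def decseq_def
        by (meson Max_ge finite_insert)
      have "A \<subseteq> L N" "B \<subseteq> L N"
        using AB(5) by blast+
      then have "\<not> L N \<subseteq> O1 \<union> O2"
        using connectedD[OF assms(2), of O1 O2 N] O AB(3,4) by blast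
      then show "L 0 \<inter> (\<Inter>n\<in>I. L n - (O1 \<union> O2)) \<noteq> {}"
        using N by blast
    qed
    then obtain x where x: "\<And>n. x \<in> L n - (O1 \<union> O2)"
      by blast
    then have "x \<in> A \<union> B"
      unfolding AB(5) by blast
    then show False
      using x O(3,4) by blast
  qed
  moreover have "closed (\<Inter>n. L n)"
    using cl by blast
  ultimately show ?thesis
    using connected_closed_set[of "\<Inter>n. L n"] by metis
qed

text \<open>Points that no \<open>K n\<close> separates lie in one component of the intersection. So
  \<open>Suc m\<close> distinct components would already be separated in a single
  \<open>K N\<close>, which contradicts the pigeonhole principle for the at most \<open>m\<close>
  connected pieces of \<open>K N\<close>.\<close>

lemma finite_components_INT_decseq:
  fixes K :: "nat \<Rightarrow> 'a::t4_space set"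
  assumes comp: "\<And>n. compact (K n)" and dec: "decseq K"
    and K: "\<And>n. K n = \<Union> (D n)"
    and D: "\<And>n. finite (D n)" "\<And>n. card (D n) \<le> m" "\<And>n T. T \<in> D n \<Longrightarrow> connected T"
  shows "finite (components (\<Inter>n. K n))"
proof (rule ccontr)
  let ?K = "\<Inter>n. K n"
  have dec': "K n \<subseteq> K k" if "k \<le> n" for k n
    using dec that by (simp add: decseq_def)
  have merge: "connected_component ?K x y"
    if xy: "\<And>n. connected_component (K n) x y" for x y
  proof -
    \<comment> \<open>The components of \<open>x\<close> in the sets \<open>K n\<close> are compact
      and decreasing; their intersection is the connected set that joins \<open>x\<close> to
      \<open>y\<close>.\<close>
    have "connected (\<Inter>n. connected_component_set (K n) x)"
    proof (rule connected_INT_decseq)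
      show "compact (connected_component_set (K n) x)" for n
        using compact_Int_closed[OF comp closed_connected_component[OF compact_imp_closed[OF comp]],
            of n n x] connected_component_subset[of "K n" x] by (simp add: inf.absorb2)
      show "decseq (\<lambda>n. connected_component_set (K n) x)"
        unfolding decseq_def by (simp add: connected_component_mono dec')
    qed auto
    moreover have "(\<Inter>n. connected_component_set (K n) x) \<subseteq> ?K"
      using connected_component_subset by fast
    moreover have "x \<in> (\<Inter>n. connected_component_set (K n) x)"
      using xy connected_component_in connected_component_refl by fastforce
    ultimately show ?thesis
      using xy unfolding connected_component_def[of ?K] by blast
  qed
  assume "infinite (components ?K)"
  then obtain \<C> where \<C>: "finite \<C>" "card \<C> = Suc m" "\<C> \<subseteq> components ?K"
    by (meson infinite_arbitrarily_large)
  define p where "p C = (SOME x. x \<in> C)" for C :: "'a set"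
  have p: "p C \<in> C" "p C \<in> ?K" if "C \<in> \<C>" for C
  proof -
    show "p C \<in> C"
      using that \<C> in_components_nonempty some_in_eq unfolding p_def by blast
    then show "p C \<in> ?K"
      using that \<C> in_components_subset by blast
  qed
  have sep: "\<exists>n. \<not> connected_component (K n) (p B) (p C)"
    if "B \<in> \<C>" "C \<in> \<C>" "B \<noteq> C" for B C
  proof (rule ccontr)
    assume "\<not> ?thesis"
    then have "connected_component ?K (p B) (p C)"
      by (intro merge) auto
    moreover have "B = connected_component_set ?K (p B)" "C = connected_component_set ?K (p C)"
      using p \<C> that by (metis (no_types, lifting) components_iff connected_component_eq subsetD)+
    ultimately show False
      using \<open>B \<noteq> C\<close> connected_component_eq_eq by (metis p(2) that(1,2))
  qed
  obtain n where n: "\<And>B C. B \<in> \<C> \<Longrightarrow> C \<in> \<C> \<Longrightarrow> B \<noteq> C \<Longrightarrow> \<not> connected_component (K (n B C)) (p B) (p C)"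
    using sep by metis
  \<comment> \<open>Separation at one stage persists at all later ones, because \<open>K\<close>
    decreases; the largest of the finitely many stages therefore serves all pairs.\<close>
  define N where "N = Max ((\<lambda>(B, C). n B C) ` (\<C> \<times> \<C>))"
  have N: "\<not> connected_component (K N) (p B) (p C)" if "B \<in> \<C>" "C \<in> \<C>" "B \<noteq> C" for B C
  proof -
    have "n B C \<le> N"
      unfolding N_def using \<C>(1) that by (intro Max_ge) auto
    then show ?thesis
      using n[OF that] dec' connected_component_of_subset by blast
  qed
  have "\<exists>T. T \<in> D N \<and> p C \<in> T" if "C \<in> \<C>" for C
    using p(2)[OF that] K by blast
  then obtain d where d: "\<And>C. C \<in> \<C> \<Longrightarrow> d C \<in> D N \<and> p C \<in> d C"
    by metis
  have "inj_on d \<C>"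
  proof (rule inj_onI, rule ccontr)
    fix B C assume BC: "B \<in> \<C>" "C \<in> \<C>" "d B = d C" "B \<noteq> C"
    have "connected (d B)" "d B \<subseteq> K N" "p B \<in> d B" "p C \<in> d B"
      using d[OF BC(1)] d[OF BC(2)] BC(3) D(3) K by auto
    then show False
      using N[OF BC(1,2,4)] unfolding connected_component_def by blast
  qed
  then have "card \<C> \<le> card (D N)"
    using d D(1) card_inj_on_le by blast
  then show False
    using \<C>(2) D(2)[of N] by simp
qed

section \<open>Components of open sets in locally connected spaces\<close>

lemma open_component_locally_connected_UNIV:
  fixes W :: "'a::topological_space set"
  assumes "locally connected (UNIV :: 'a set)" "open W" "C \<in> components W"
  shows "open C"
  using assms locally_connected_open_component[of "UNIV :: 'a set"] by auto

text \<open>The components of \<open>W\<close> form a disjoint open cover of \<open>K\<close>. By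
  disjointness a finite subcover must contain every component that meets \<open>K\<close>.\<close>

lemma finite_components_meeting_compact:
  fixes W :: "'a::topological_space set"
  assumes lc: "locally connected (UNIV :: 'a set)" and W: "open W"
    and K: "compact K" "K \<subseteq> W"
  shows "finite {C \<in> components W. C \<inter> K \<noteq> {}}"
proof -
  have "K \<subseteq> \<Union> (components W)"
    using K by simp
  then obtain \<F> where \<F>: "\<F> \<subseteq> components W" "finite \<F>" "K \<subseteq> \<Union> \<F>"
    using compactE[OF K(1)] open_component_locally_connected_UNIV[OF lc W] by metis
  have "{C \<in> components W. C \<inter> K \<noteq> {}} \<subseteq> \<F>"
  proof
    fix C assume "C \<in> {C \<in> components W. C \<inter> K \<noteq> {}}"
    then obtain x B where "C \<in> components W" "x \<in> C" "B \<in> \<F>" "x \<in> B"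
      using \<F>(3) by blast
    then show "C \<in> \<F>"
      using components_eq[of C W B] \<F>(1) by blast
  qed
  then show ?thesis
    using \<F>(2) finite_subset by blast
qed

section \<open>Iterates of a homeomorphism and complementary components\<close>

lemma homeomorphism_funpow:
  assumes "homeomorphism S S f g"
  shows "homeomorphism S S (f ^^ n) (g ^^ n)"
proof (induction n)
  case 0
  then show ?case by (simp add: id_def homeomorphism_def)
next
  case (Suc n)
  then have "homeomorphism S S (f \<circ> f ^^ n) (g ^^ n \<circ> g)"
    using assms homeomorphism_compose by blast
  then show ?case
    by (metis funpow.simps(2) funpow_Suc_right)
qed

lemma homeomorphism_image_component:
  assumes hom: "homeomorphism UNIV UNIV f g" and C: "C \<in> components S"
  shows "f ` C \<in> components (f ` S)"
proof -
  have gf: "g ` f ` A = A" "f ` g ` B = B" for A B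
    using hom unfolding homeomorphism_def by (auto simp: image_image)
  have con: "continuous_on A f" "continuous_on B g" for A B
    using hom unfolding homeomorphism_def by (meson continuous_on_subset subset_UNIV)+
  show ?thesis
    unfolding in_components_maximal
  proof (intro conjI allI impI)
    show "f ` C \<noteq> {}" "f ` C \<subseteq> f ` S"
      using in_components_nonempty[OF C] in_components_subset[OF C] by auto
    show "connected (f ` C)"
      using connected_continuous_image con in_components_connected[OF C] by blast
    fix T assume T: "T \<noteq> {} \<and> f ` C \<subseteq> T \<and> T \<subseteq> f ` S \<and> connected T"
    then have "C \<subseteq> g ` T" "g ` T \<subseteq> S"
      using gf(1) image_mono by metis+
    moreover have "connected (g ` T)"
      using connected_continuous_image[OF con(2)] T by metis
    ultimately have "g ` T = C"
      using C T unfolding in_components_maximal by (metis image_is_empty)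
    then show "T = f ` C"
      using gf(2) by metis
  qed
qed

text \<open>By \<open>sub\<close>, \<open>D\<close> has no limit points in \<open>W\<close> outside
  \<open>V\<close>, so it is relatively closed as well as open in \<open>W\<close>. This will
  promote components of \<open>U - \<Lambda>\<close> to components of
  \<open>- \<Lambda>\<close>.\<close>

lemma component_of_open_superset:
  assumes D: "D \<in> components V" "open D" and "V \<subseteq> W" and sub: "closure D \<inter> W \<subseteq> V"
  shows "D \<in> components W"
proof -
  have DW: "connected D" "D \<noteq> {}" "D \<subseteq> W"
    using D in_components_connected in_components_nonempty in_components_subset \<open>V \<subseteq> W\<close> by blast+
  then obtain E where E: "E \<in> components W" "D \<subseteq> E"
    using exists_component_superset[of D W] by blast
  \<comment> \<open>A set between \<open>D\<close> and its closure is connected, and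
    \<open>sub\<close> keeps this one inside \<open>V\<close>, where \<open>D\<close> is
    maximal.\<close>
  have "connected (closure D \<inter> E)"
    using connected_intermediate_closure[OF DW(1), of "closure D \<inter> E"] E closure_subset by blast
  moreover have "closure D \<inter> E \<subseteq> V"
    using E sub in_components_subset by blast
  moreover have "D \<inter> (closure D \<inter> E) \<noteq> {}"
    using DW(2) E closure_subset by blast
  ultimately have clo: "closure D \<inter> E \<subseteq> D"
    using components_maximal[OF D(1)] by blast
  have "E \<subseteq> D"
  proof (rule ccontr)
    assume "\<not> E \<subseteq> D"
    moreover have "E \<subseteq> D \<union> - closure D"
      using clo by blast
    ultimately show False
      using connectedD[OF in_components_connected[OF E(1)], of D "- closure D"] D(2) DW(2) E(2)
        closure_subset[of D] by blast
  qed
  then show ?thesis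
    using E by auto
qed

lemma decseq_funpow_image:
  assumes "f ` A \<subseteq> A"
  shows "decseq (\<lambda>n. (f ^^ n) ` A)"
proof (rule decseq_SucI)
  fix n
  have "(f ^^ Suc n) ` A = (f ^^ n) ` f ` A"
    by (simp only: funpow_Suc_right image_comp)
  then show "(f ^^ Suc n) ` A \<subseteq> (f ^^ n) ` A"
    using assms by (simp add: image_mono)
qed

lemma no_complementary_component_in_trapping_region:
  fixes f g :: "'a::t2_space \<Rightarrow> 'a"
  assumes comp: "compact (UNIV :: 'a set)" and lc: "locally connected (UNIV :: 'a set)"
    and hom: "homeomorphism UNIV UNIV f g"
    and "closed \<Lambda>" "f ` \<Lambda> = \<Lambda>" "open U" "f ` U \<subseteq> U" and \<Lambda>: "\<Lambda> = (\<Inter>i. (f ^^ i) ` U)"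
    and E: "E \<in> components (- \<Lambda>)"
  shows "\<not> E \<subseteq> U"
proof
  assume "E \<subseteq> U"
  have fg: "f (g x) = x" "g (f x) = x" for x
    using hom by (auto simp: homeomorphism_def)
  have fgn: "(f ^^ n) ((g ^^ n) x) = x" for n x
    using homeomorphism_funpow[OF hom, of n] by (auto simp: homeomorphism_def)
  have "g ` \<Lambda> = \<Lambda>"
    using \<open>f ` \<Lambda> = \<Lambda>\<close> fg by (metis (no_types, lifting) image_image image_ident image_cong)
  moreover have "bij g"
    using fg by (metis bijI')
  ultimately have "g ` (- \<Lambda>) = - \<Lambda>"
    by (simp add: bij_image_Compl_eq)
  then have gE: "(g ^^ n) ` E \<in> components (- \<Lambda>)" for n
  proof (induction n)
    case (Suc n)
    then show ?case
      using homeomorphism_image_component[OF homeomorphism_symD[OF hom] Suc.IH]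
      by (simp add: image_comp)
  qed (use E in simp)
  obtain x where x: "x \<in> E" "x \<notin> \<Lambda>"
    using in_components_nonempty[OF E] in_components_subset[OF E] by blast
  then obtain N where "x \<notin> (f ^^ N) ` U"
    using \<Lambda> by blast
  \<comment> \<open>The sets \<open>(f ^^ n)(U)\<close> decrease, so \<open>x\<close> stays outside
    them from \<open>N\<close> on; equivalently, its backward orbit stays outside
    \<open>U\<close>.\<close>
  then have "x \<notin> (f ^^ n) ` U" if "n \<ge> N" for n
    using decseq_funpow_image[OF \<open>f ` U \<subseteq> U\<close>] that unfolding decseq_def by blast
  then have "(g ^^ n) x \<notin> U" if "n \<ge> N" for n
    using that fgn by (metis imageI)
  then have sub: "(\<lambda>n. (g ^^ n) ` E) ` {N..} \<subseteq> {C \<in> components (- \<Lambda>). C \<inter> - U \<noteq> {}}"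
    using gE x(1) by blast
  have "\<Lambda> \<subseteq> U"
    using \<Lambda> by (metis INT_lower UNIV_I funpow_0 image_cong image_ident)
  moreover have "compact (- U)"
    using comp \<open>open U\<close> by (metis Compl_eq_Diff_UNIV compact_diff)
  ultimately have "finite {C \<in> components (- \<Lambda>). C \<inter> - U \<noteq> {}}"
    using \<open>closed \<Lambda>\<close> by (intro finite_components_meeting_compact lc) auto
  \<comment> \<open>Infinitely many times against finitely many components: two backward iterates of
    \<open>E\<close> coincide, which gives the period \<open>p\<close>.\<close>
  then have "\<not> inj_on (\<lambda>n. (g ^^ n) ` E) {N..}"
    using sub finite_subset finite_imageD infinite_Ici by blast
  then obtain a b where ab: "a < b" "(g ^^ a) ` E = (g ^^ b) ` E"
    unfolding inj_on_def by (metis linorder_neqE_nat)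
  define p where "p = b - a"
  have "(f ^^ b) ` (g ^^ b) ` E = E"
    using fgn by (simp add: image_image)
  moreover have "(f ^^ b) ` (g ^^ a) ` E = (f ^^ p) ` E"
  proof -
    have "f ^^ b = f ^^ p \<circ> f ^^ a"
      unfolding p_def using ab(1) by (simp flip: funpow_add)
    then show ?thesis
      using fgn by (simp add: image_image)
  qed
  ultimately have per: "(f ^^ p) ` E = E"
    using ab(2) by simp
  have "E \<subseteq> (f ^^ k) ` U" for k
  proof (induction k)
    case (Suc k)
    \<comment> \<open>Applying the period gains \<open>p\<close> iterates, and \<open>p\<close> is
      at least 1, so the induction advances.\<close>
    have "E \<subseteq> (f ^^ p) ` (f ^^ k) ` U"
      using per Suc by (metis image_mono)
    also have "\<dots> = (f ^^ (p + k)) ` U"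
      by (simp add: funpow_add image_comp)
    also have "\<dots> \<subseteq> (f ^^ Suc k) ` U"
      using decseq_funpow_image[OF \<open>f ` U \<subseteq> U\<close>] ab(1) unfolding decseq_def p_def
      by (simp del: funpow.simps)
    finally show ?case .
  qed (use \<open>E \<subseteq> U\<close> in simp)
  then show False
    using x \<Lambda> by blast
qed

section \<open>Approximating the boundary of the attractor by finitely many connected pieces\<close>

theorem theoremA1:
  fixes f g :: "'a::metric_space \<Rightarrow> 'a" and \<Lambda> :: "'a set"
  assumes "compact (UNIV :: 'a set)"
    and "homeomorphism UNIV UNIV f g"
    and "attractor f \<Lambda>"
    and "locally connected (UNIV :: 'a set)"
  shows "finite (components (frontier \<Lambda>))"
proof -
  note comp = assms(1) and hom = assms(2) and lc = assms(4)
  obtain U where "closed \<Lambda>" "f ` \<Lambda> = \<Lambda>" "open U" and trap: "f ` closure U \<subseteq> U"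
    and \<Lambda>: "\<Lambda> = (\<Inter>i. (f ^^ i) ` U)"
    using assms(3) unfolding attractor_def by blast
  have closed_compact: "compact A" if "closed A" for A :: "'a set"
    using comp that by (metis compact_Int_closed Int_UNIV_left)
  have fU: "f ` U \<subseteq> U"
    using trap closure_subset by blast
  have homn: "homeomorphism UNIV UNIV (f ^^ n) (g ^^ n)" for n
    using homeomorphism_funpow[OF hom] .
  have cont: "continuous_on A (f ^^ n)" for A n
    using homn[of n] unfolding homeomorphism_def by (meson continuous_on_subset subset_UNIV)
  have \<Lambda>n: "(f ^^ n) ` \<Lambda> = \<Lambda>" for n
  proof (induction n)
    case (Suc n)
    then show ?case
      using \<open>f ` \<Lambda> = \<Lambda>\<close> by (metis funpow.simps(2) image_comp)
  qed simp
  have \<Lambda>fU: "\<Lambda> \<subseteq> f ` U"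
    using \<Lambda> INT_lower[of 1 UNIV "\<lambda>i. (f ^^ i) ` U"] by simp
  have openn: "open ((f ^^ n) ` A)" if "open A" for n A
    using homeomorphism_imp_open_map[OF homn, of A n] that by simp
  have injn: "inj (f ^^ n)" for n
    using homn[of n] unfolding homeomorphism_def by (metis inj_on_inverseI UNIV_I)
  have clfU: "closure (f ` U) \<subseteq> U"
  proof -
    have "compact (f ` closure U)"
      using compact_continuous_image[of "closure U" f] cont[of _ 1] closed_compact by simp
    then have "closure (f ` U) \<subseteq> f ` closure U"
      by (intro closure_minimal image_mono closure_subset compact_imp_closed)
    then show ?thesis
      using trap by blast
  qed
  \<comment> \<open>Only components reaching \<open>f(U)\<close> are kept, since an arbitrary
    \<open>U\<close> may contribute infinitely many others.\<close>
  define \<C> where "\<C> = {C \<in> components (U - \<Lambda>). C \<inter> f ` U \<noteq> {}}"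
  have "open (U - \<Lambda>)"
    using \<open>open U\<close> \<open>closed \<Lambda>\<close> by (rule open_Diff)
  have "C \<inter> frontier (f ` U) \<noteq> {}" if "C \<in> \<C>" for C
  proof (rule connected_Int_frontier)
    have C: "C \<in> components (U - \<Lambda>)"
      using that \<C>_def by auto
    show "connected C" "C \<inter> f ` U \<noteq> {}"
      using that \<C>_def in_components_connected by auto
    show "C - f ` U \<noteq> {}"
    proof
      assume *: "C - f ` U = {}"
      \<comment> \<open>If \<open>C\<close> lay inside \<open>f(U)\<close>, its closure would stay
        in \<open>U\<close>, so \<open>C\<close> would be a whole component of
        \<open>- \<Lambda>\<close> inside the trapping region.\<close>
      then have "closure C \<subseteq> U"
        using clfU closure_mono by blast
      then have C\<Lambda>: "C \<in> components (- \<Lambda>)"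
        using open_component_locally_connected_UNIV[OF lc \<open>open (U - \<Lambda>)\<close> C]
        by (intro component_of_open_superset[OF C]) auto
      show False
        using no_complementary_component_in_trapping_region[OF comp lc hom \<open>closed \<Lambda>\<close>
            \<open>f ` \<Lambda> = \<Lambda>\<close> \<open>open U\<close> fU \<Lambda> C\<Lambda>] * fU by blast
    qed
  qed
  then have "\<C> \<subseteq> {C \<in> components (U - \<Lambda>). C \<inter> frontier (f ` U) \<noteq> {}}"
    unfolding \<C>_def by blast
  \<comment> \<open>The frontier lies in \<open>U\<close> by \<open>clfU\<close>, and it misses
    \<open>\<Lambda>\<close> because \<open>\<Lambda>\<close> is contained in the open set
    \<open>f(U)\<close>.\<close>
  moreover have "finite {C \<in> components (U - \<Lambda>). C \<inter> frontier (f ` U) \<noteq> {}}"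
  proof (rule finite_components_meeting_compact[OF lc \<open>open (U - \<Lambda>)\<close>])
    show "compact (frontier (f ` U))"
      using closed_compact by simp
    have "open (f ` U)"
      using openn[OF \<open>open U\<close>, of 1] by simp
    then show "frontier (f ` U) \<subseteq> U - \<Lambda>"
      using clfU \<Lambda>fU by (auto simp: frontier_def interior_open)
  qed
  ultimately have fin: "finite \<C>"
    using finite_subset by blast
  define P where "P = \<Union> \<C>"
  \<comment> \<open>The lower bound makes \<open>P\<close> forward invariant and lets its images
    surround \<open>\<Lambda>\<close>; the upper bound forces the images of its closure to shrink
    into \<open>\<Lambda>\<close>.\<close>
  have P: "f ` U - \<Lambda> \<subseteq> P" "P \<subseteq> U - \<Lambda>"
  proof -
    show "f ` U - \<Lambda> \<subseteq> P"
    proof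
      fix x assume "x \<in> f ` U - \<Lambda>"
      moreover from this obtain C where "C \<in> components (U - \<Lambda>)" "x \<in> C"
        using fU Union_components[of "U - \<Lambda>"] by blast
      ultimately show "x \<in> P"
        unfolding P_def \<C>_def by blast
    qed
    show "P \<subseteq> U - \<Lambda>"
      unfolding P_def \<C>_def using in_components_subset by blast
  qed
  have fP: "f ` P \<subseteq> P"
  proof -
    have "f ` P \<subseteq> f ` (U - \<Lambda>)"
      using P by blast
    also have "\<dots> = f ` U - f ` \<Lambda>"
      using injn[of 1] by (simp add: image_set_diff)
    finally show ?thesis
      using P \<open>f ` \<Lambda> = \<Lambda>\<close> by blast
  qed
  have fclP: "f ` closure P \<subseteq> closure P"
    using image_closure_subset[of P f "closure P"] cont[of _ 1] fP closure_subset[of P] by auto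
  define K where "K n = (f ^^ n) ` closure P" for n
  have compK: "compact (K n)" for n
    unfolding K_def using compact_continuous_image[OF cont] closed_compact by simp
  have "frontier \<Lambda> = (\<Inter>n. K n)"
  proof
    show "frontier \<Lambda> \<subseteq> (\<Inter>n. K n)"
    proof (intro INT_greatest)
      fix n
      let ?V = "(f ^^ Suc n) ` U"
      have "?V - \<Lambda> = (f ^^ n) ` (f ` U - \<Lambda>)"
        using injn[of n] \<Lambda>n[of n]
        by (simp add: image_set_diff image_comp funpow_Suc_right del: funpow.simps)
      then have "?V - \<Lambda> \<subseteq> K n"
        unfolding K_def using P closure_subset[of P] by blast
      then have "closure (?V - \<Lambda>) \<subseteq> K n"
        using compK compact_imp_closed closure_minimal by blast
      \<comment> \<open>A boundary point of \<open>\<Lambda>\<close> has the open set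
        \<open>?V\<close> as a neighbourhood, so points of \<open>- \<Lambda>\<close> approach it
        from within \<open>?V\<close>.\<close>
      moreover have "frontier \<Lambda> \<subseteq> closure (?V - \<Lambda>)"
      proof -
        have "\<Lambda> \<subseteq> ?V"
          using \<Lambda> by blast
        then have "frontier \<Lambda> \<subseteq> ?V \<inter> closure (- \<Lambda>)"
          using \<open>closed \<Lambda>\<close> by (auto simp: frontier_closures)
        also have "\<dots> \<subseteq> closure (?V \<inter> - \<Lambda>)"
          using open_Int_closure_subset openn[OF \<open>open U\<close>] by blast
        finally show ?thesis
          by (simp add: Diff_eq)
      qed
      ultimately show "frontier \<Lambda> \<subseteq> K n"
        by blast
    qed
    show "(\<Inter>n. K n) \<subseteq> frontier \<Lambda>"
    proof -
      \<comment> \<open>The index shifts because \<open>closure P\<close> is only known to lie in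
        \<open>closure U\<close>; one application of \<open>f\<close> brings it into
        \<open>U\<close>.\<close>
      have "K (Suc n) \<subseteq> (f ^^ n) ` U" for n
      proof -
        have "K (Suc n) = (f ^^ n) ` f ` closure P"
          unfolding K_def by (simp only: funpow_Suc_right image_comp)
        also have "\<dots> \<subseteq> (f ^^ n) ` U"
          using trap closure_mono[of P U] P by (intro image_mono) blast
        finally show ?thesis .
      qed
      then have "(\<Inter>n. K n) \<subseteq> \<Lambda>"
        unfolding \<Lambda> by blast
      \<comment> \<open>For a point already in \<open>\<Lambda>\<close>, being a limit of the
        complement is what makes it a boundary point.\<close>
      moreover have "K 0 \<subseteq> closure (- \<Lambda>)"
        unfolding K_def using P closure_mono[of P "- \<Lambda>"] by auto
      ultimately show ?thesis
        using \<open>closed \<Lambda>\<close> unfolding frontier_closures by auto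
    qed
  qed
  moreover have "finite (components (\<Inter>n. K n))"
  proof (rule finite_components_INT_decseq)
    \<comment> \<open>Closure commutes with this union because \<open>\<C>\<close> is finite, so
      each \<open>K n\<close> splits into at most \<open>card \<C>\<close> connected images.\<close>
    have clP: "closure P = (\<Union>C\<in>\<C>. closure C)"
      unfolding P_def using fin by induction auto
    let ?D = "\<lambda>n. (\<lambda>C. (f ^^ n) ` closure C) ` \<C>"
    show "decseq K"
      unfolding K_def using decseq_funpow_image[OF fclP] .
    show "K n = \<Union> (?D n)" for n
      unfolding K_def clP by auto
    show "finite (?D n)" "card (?D n) \<le> card \<C>" for n
      using fin card_image_le by auto
    show "connected T" if "T \<in> ?D n" for n T
    proof -
      obtain C where C: "C \<in> \<C>" "T = (f ^^ n) ` closure C"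
        using \<open>T \<in> ?D n\<close> by blast
      then have "connected C"
        using \<C>_def in_components_connected by blast
      then show ?thesis
        unfolding C(2) by (intro connected_continuous_image[OF cont] connected_imp_connected_closure)
    qed
  qed (fact compK)
  ultimately show ?thesis
    by simp
qed

end
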